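(* Let $\ell\ge1$. The fair multiplication protocol $\Pi_{\mathsf{Mult}}(\mathsf a,\mathsf b,\mathsf{isTr})$ (described in the context) on $[\![\cdot]\!]$-shared inputs $\mathsf a,\mathsf b\in\mathbb Z_{2^\ell}$, for either value of the truncation bit $\mathsf{isTr}\in\{0,1\}$, requires (in the amortized sense) $2\ell$ bits of communication in the preprocessing phase, and $1$ round and $3\ell$ bits of communication in the online phase.
   Context: Setting: four parties $P_0,P_1,P_2,P_3$ with pairwise private authenticated synchronous channels; every subset of at least two parties holds a common pseudorandom-function key (one-time setup), so any such subset can sample common random elements without communication. $\mathsf H$ is a collision-resistant hash function with output of fixed length. For $\mathsf x\in\mathbb Z_{2^\ell}$, $\mathsf x^{\mathsf t}$ is $\mathsf x$ (as a signed two's complement integer) truncated by a fixed number of low-order bits. Sharing: $\mathsf{v}\in\mathbb{Z}_{2^\ell}$ is $[\![\cdot]\!]$-shared via $\lambda^1_{\mathsf v},\lambda^2_{\mathsf v},\lambda^3_{\mathsf v}$ and $\mathsf{m}_{\mathsf v}=\mathsf v+\lambda_{\mathsf v}$, $\lambda_{\mathsf v}=\lambda^1_{\mathsf v}+\lambda^2_{\mathsf v}+\lambda^3_{\mathsf v}$, where $P_0$ holds $(\lambda^1_{\mathsf v},\lambda^2_{\mathsf v},\lambda^3_{\mathsf v})$, $P_1$ holds $(\mathsf m_{\mathsf v},\lambda^1_{\mathsf v},\lambda^3_{\mathsf v})$, $P_2$ holds $(\mathsf m_{\mathsf v},\lambda^2_{\mathsf v},\lambda^3_{\mathsf v})$,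 $P_3$ holds $(\mathsf m_{\mathsf v},\lambda^1_{\mathsf v},\lambda^2_{\mathsf v})$. The sharing is linear. Joint-send: "$P_i,P_j$ $\mathsf{jsnd}$ $\mathsf x$ to $P_k$" means $P_i$ sends $\mathsf x$ to $P_k$ and $P_j$ sends $\mathsf H(\mathsf x)$ to $P_k$, who aborts if they are inconsistent; hashes are combined over all instances and sent once at the end. Joint sharing $\Pi_{\mathsf{JSh}}$: $\Pi_{\mathsf{JSh}}(P_0,P_3,\mathsf v)$ (preprocessing): $P_0,P_2,P_3$ sample $\lambda^2_{\mathsf v}$; set $\lambda^3_{\mathsf v}=\mathsf m_{\mathsf v}=0$; $P_0,P_3$ $\mathsf{jsnd}$ $\lambda^1_{\mathsf v}=-\mathsf v-\lambda^2_{\mathsf v}$ to $P_1$. $\Pi_{\mathsf{JSh}}(P_1,P_2,\mathsf v)$ (online): in preprocessing the $\lambda$-shares are sampled non-interactively so that $P_1,P_2$ both know all of $\lambda_{\mathsf v}$; online $P_1,P_2$ $\mathsf{jsnd}$ $\mathsf m_{\mathsf v}=\mathsf v+\lambda_{\mathsf v}$ to $P_3$. Protocol $\Pi_{\mathsf{Mult}}(\mathsf a,\mathsf b,\mathsf{isTr})$ for $\mathsf z=\mathsf{ab}$. Preprocessing: (1) Locally, $P_0,P_1$ compute $\gamma^1=\lambda_{\mathsf a}^1\lambda_{\mathsf b}^3+\lambda_{\mathsf a}^3\lambda_{\mathsf b}^1+\lambda_{\mathsf a}^3\lambda_{\mathsf b}^3$; $P_0,P_2$ compute $\gamma^2=\lambda_{\mathsf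 a}^2\lambda_{\mathsf b}^3+\lambda_{\mathsf a}^3\lambda_{\mathsf b}^2+\lambda_{\mathsf a}^2\lambda_{\mathsf b}^2$; $P_0,P_3$ compute $\gamma^3=\lambda_{\mathsf a}^1\lambda_{\mathsf b}^2+\lambda_{\mathsf a}^2\lambda_{\mathsf b}^1+\lambda_{\mathsf a}^1\lambda_{\mathsf b}^1$. (2) $P_0,P_3,P_j$ sample random $\mathsf u^j\in\mathbb Z_{2^\ell}$, $j\in\{1,2\}$. (3) $P_0,P_3$ compute $\mathsf r=\gamma^3-\mathsf u^1-\mathsf u^2$, set $\mathsf q=\mathsf r^{\mathsf t}$ if $\mathsf{isTr}=1$ and $\mathsf q=\mathsf r$ otherwise, and execute $\Pi_{\mathsf{JSh}}(P_0,P_3,\mathsf q)$. (4) $P_0,P_1,P_2$ sample random $\mathsf s_1,\mathsf s_2$ and set $\mathsf s=\mathsf s_1+\mathsf s_2$; $P_0$ sends $\mathsf w=\gamma^1+\gamma^2+\mathsf s$ to $P_3$. Online: (1) $P_1$ computes $\mathsf y_1=-\lambda_{\mathsf a}^1\mathsf m_{\mathsf b}-\lambda_{\mathsf b}^1\mathsf m_{\mathsf a}+\gamma^1+\mathsf u^1$; $P_2$ computes $\mathsf y_2=-\lambda_{\mathsf a}^2\mathsf m_{\mathsf b}-\lambda_{\mathsf b}^2\mathsf m_{\mathsf a}+\gamma^2+\mathsf u^2$; both compute $\mathsf y_3=-\lambda_{\mathsf a}^3\mathsf m_{\mathsf b}-\lambda_{\mathsf b}^3\mathsf m_{\mathsf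 a}$. (2) $P_1$ sends $\mathsf y_1$ to $P_2$, $P_2$ sends $\mathsf y_2$ to $P_1$; they compute $\mathsf z-\mathsf r=\mathsf y_1+\mathsf y_2+\mathsf y_3+\mathsf m_{\mathsf a}\mathsf m_{\mathsf b}$. (3) They set $\mathsf p=(\mathsf z-\mathsf r)^{\mathsf t}$ if $\mathsf{isTr}=1$, else $\mathsf p=\mathsf z-\mathsf r$, and execute $\Pi_{\mathsf{JSh}}(P_1,P_2,\mathsf p)$. (4) Output $[\![\mathsf p]\!]+[\![\mathsf q]\!]$. (5) Verification: $P_3$ computes $\mathsf v=-(\lambda_{\mathsf a}^1+\lambda_{\mathsf a}^2)\mathsf m_{\mathsf b}-(\lambda_{\mathsf b}^1+\lambda_{\mathsf b}^2)\mathsf m_{\mathsf a}+\mathsf u^1+\mathsf u^2+\mathsf w$ and sends $\mathsf H(\mathsf v)$ to $P_1,P_2$, who abort iff $\mathsf H(\mathsf v)\ne\mathsf H(\mathsf y_1+\mathsf y_2+\mathsf s)$. Cost convention (amortized): communication is the limit, as the number $N$ of protocol instances tends to infinity, of (total bits sent)$/N$, where all hash messages are batched and sent once at the end of the whole computation. The communication to $P_3$ in $\Pi_{\mathsf{JSh}}(P_1,P_2,\mathsf p)$ is deferred to the verification stage at the end of the computation; its bits are counted in the online communication, but the rounds of the one-time verification stage are not counted. *)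

theory Defs
  imports Complex_Main "HOL-Library.Word"
begin

text \<open>
  The ring of integers modulo \<open>2^\<ell>\<close> is the type \<open>'l word\<close> with \<open>\<ell> = LENGTH('l)\<close>; class \<open>len\<close>
  provides \<open>\<ell> \<ge> 1\<close>. The protocol is written as a program over named local variables of the four
  parties, and a party can compute and send only what its own memory contains. Bits and rounds
  are read off the log of an honest execution.
\<close>

datatype party = P0 | P1 | P2 | P3

text \<open>The values that occur in secret-shared form: inputs \<open>a\<close>, \<open>b\<close>, intermediate \<open>p\<close>, \<open>q\<close>, output \<open>z\<close>.\<close>

datatype wire = WA | WB | WP | WQ | WZ

datatype var =
    Lam nat wire  \<comment> \<open>the share \<open>\<lambda>\<^sup>j\<close> of the value on the wire, \<open>j \<in> {1,2,3}\<close>\<close>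
  | Msk wire      \<comment> \<open>the masked value \<open>m\<close> of the wire\<close>
  | Clear wire    \<comment> \<open>the value itself, known to the dealers of a joint sharing\<close>
  | Gam nat | U nat | R | S nat | SSum | W | Y nat | ZR

datatype expr =
    Var var
  | Zero
  | Neg expr
  | Plus expr expr (infixl "\<oplus>" 65)
  | Minus expr expr (infixl "\<ominus>" 65)
  | Times expr expr (infixl "\<otimes>" 70)
  | Trunc expr

abbreviation "lam j x \<equiv> Var (Lam j x)"
abbreviation "msk x \<equiv> Var (Msk x)"

text \<open>
  Instructions. \<open>Sample ps x\<close>: the parties \<open>ps\<close> draw a common random element under their shared
  pseudorandom-function key. \<open>Confirm s r e f\<close>: \<open>s\<close> adds its value of \<open>e\<close> to the string whose hash it
  sends to \<open>r\<close> at the end, and \<open>r\<close> adds its value of \<open>f\<close> to the string whose hash it compares with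
  that.
\<close>

datatype instr =
    Sample "party list" var
  | Assign "party list" var expr
  | Send party party var
  | Confirm party party expr expr

definition jsnd :: "party \<Rightarrow> party \<Rightarrow> party \<Rightarrow> var \<Rightarrow> instr list" where
  "jsnd i j k x = [Send i k x, Confirm j k (Var x) (Var x)]"

text \<open>Joint sharing by \<open>P0\<close>, \<open>P3\<close> in the preprocessing phase.\<close>

definition jsh03 :: "wire \<Rightarrow> instr list" where
  "jsh03 x =
    [Sample [P0, P2, P3] (Lam 2 x),
     Assign [P0, P1, P2] (Lam 3 x) Zero,
     Assign [P1, P2, P3] (Msk x) Zero,
     Assign [P0, P3] (Lam 1 x) (Neg (Var (Clear x)) \<ominus> lam 2 x)]
    @ jsnd P0 P3 P1 (Lam 1 x)"

text \<open>
  Joint sharing by \<open>P1\<close>, \<open>P2\<close>. Each \<open>\<lambda>\<^sup>j\<close> is sampled by the parties that hold it in a sharing,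
  together with \<open>P1\<close> and \<open>P2\<close>. The joint send to \<open>P3\<close> is kept apart because it is deferred to the
  verification stage.
\<close>

definition jsh12_preprocessing :: "wire \<Rightarrow> instr list" where
  "jsh12_preprocessing x =
    [Sample [P0, P1, P2, P3] (Lam 1 x),
     Sample [P0, P1, P2, P3] (Lam 2 x),
     Sample [P0, P1, P2] (Lam 3 x)]"

definition jsh12_online :: "wire \<Rightarrow> instr list" where
  "jsh12_online x =
    [Assign [P1, P2] (Msk x) (Var (Clear x) \<oplus> (lam 1 x \<oplus> lam 2 x \<oplus> lam 3 x))]"

definition jsh12_deferred :: "wire \<Rightarrow> instr list" where
  "jsh12_deferred x = jsnd P1 P2 P3 (Msk x)"

definition mult_preprocessing :: "bool \<Rightarrow> instr list" where
  "mult_preprocessing isTr =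
    [Assign [P0, P1] (Gam 1)
       (lam 1 WA \<otimes> lam 3 WB \<oplus> lam 3 WA \<otimes> lam 1 WB \<oplus> lam 3 WA \<otimes> lam 3 WB),
     Assign [P0, P2] (Gam 2)
       (lam 2 WA \<otimes> lam 3 WB \<oplus> lam 3 WA \<otimes> lam 2 WB \<oplus> lam 2 WA \<otimes> lam 2 WB),
     Assign [P0, P3] (Gam 3)
       (lam 1 WA \<otimes> lam 2 WB \<oplus> lam 2 WA \<otimes> lam 1 WB \<oplus> lam 1 WA \<otimes> lam 1 WB),
     Sample [P0, P3, P1] (U 1),
     Sample [P0, P3, P2] (U 2),
     Assign [P0, P3] R (Var (Gam 3) \<ominus> Var (U 1) \<ominus> Var (U 2)),
     Assign [P0, P3] (Clear WQ) (if isTr then Trunc (Var R) else Var R)]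
    @ jsh03 WQ @
    [Sample [P0, P1, P2] (S 1),
     Sample [P0, P1, P2] (S 2),
     Assign [P0, P1, P2] SSum (Var (S 1) \<oplus> Var (S 2)),
     Assign [P0] W (Var (Gam 1) \<oplus> Var (Gam 2) \<oplus> Var SSum),
     Send P0 P3 W]
    @ jsh12_preprocessing WP"

definition mult_online :: "bool \<Rightarrow> instr list" where
  "mult_online isTr =
    [Assign [P1] (Y 1)
       (Neg (lam 1 WA \<otimes> msk WB) \<ominus> lam 1 WB \<otimes> msk WA \<oplus> Var (Gam 1) \<oplus> Var (U 1)),
     Assign [P2] (Y 2)
       (Neg (lam 2 WA \<otimes> msk WB) \<ominus> lam 2 WB \<otimes> msk WA \<oplus> Var (Gam 2) \<oplus> Var (U 2)),
     Assign [P1, P2] (Y 3) (Neg (lam 3 WA \<otimes> msk WB) \<ominus> lam 3 WB \<otimes> msk WA),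
     Send P1 P2 (Y 1),
     Send P2 P1 (Y 2),
     Assign [P1, P2] ZR (Var (Y 1) \<oplus> Var (Y 2) \<oplus> Var (Y 3) \<oplus> msk WA \<otimes> msk WB),
     Assign [P1, P2] (Clear WP) (if isTr then Trunc (Var ZR) else Var ZR)]
    @ jsh12_online WP @
    [Assign [P0, P1, P3] (Lam 1 WZ) (lam 1 WP \<oplus> lam 1 WQ),
     Assign [P0, P2, P3] (Lam 2 WZ) (lam 2 WP \<oplus> lam 2 WQ),
     Assign [P0, P1, P2] (Lam 3 WZ) (lam 3 WP \<oplus> lam 3 WQ),
     Assign [P1, P2] (Msk WZ) (msk WP \<oplus> msk WQ)]"

text \<open>
  The stage run once at the end of the whole computation. \<open>P3\<close> can complete its share of the
  output only here, when it obtains the masked value of \<open>p\<close>.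
\<close>

definition mult_verification :: "instr list" where
  "mult_verification =
    jsh12_deferred WP @
    [Assign [P3] (Msk WZ) (msk WP \<oplus> msk WQ)] @
    (let v = Neg ((lam 1 WA \<oplus> lam 2 WA) \<otimes> msk WB) \<ominus> (lam 1 WB \<oplus> lam 2 WB) \<otimes> msk WA
               \<oplus> Var (U 1) \<oplus> Var (U 2) \<oplus> Var W;
         v' = Var (Y 1) \<oplus> Var (Y 2) \<oplus> Var SSum
     in [Confirm P3 P1 v v', Confirm P3 P2 v v'])"

text \<open>
  A memory cell holds a ring element and the number of rounds of the current phase after which
  the party knows it. This measures rounds by causal dependency: a message is sent in the first
  round in which its sender can compute it, and all independent messages travel in parallel.
\<close>

type_synonym 'l memory = "party \<times> var \<Rightarrow> ('l word \<times> nat) option"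

datatype stage = Preprocessing | Online | Verification

text \<open>
  \<open>Message st s r k bs\<close>: \<open>s\<close> sends the bit string \<open>bs\<close> to \<open>r\<close> in round \<open>k\<close> of stage \<open>st\<close>.
  \<open>Claim st s r bs bs'\<close>: \<open>s\<close> contributes \<open>bs\<close> to its batched hash for \<open>r\<close>, and \<open>r\<close> expects \<open>bs'\<close>.
\<close>

datatype event =
    Message stage party party nat "bool list"
  | Claim stage party party "bool list" "bool list"

type_synonym 'l config = "'l memory \<times> event list"

definition encode :: "'l::len word \<Rightarrow> bool list" where
  "encode x = map (bit x) [0..<LENGTH('l)]"

fun lift2 :: "('l word \<Rightarrow> 'l word \<Rightarrow> 'l word) \<Rightarrow>
    ('l word \<times> nat) option \<Rightarrow> ('l word \<times> nat) option \<Rightarrow> ('l::len word \<times> nat) option" where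
  "lift2 g (Some (x, t)) (Some (y, u)) = Some (g x y, max t u)"
| "lift2 g _ _ = None"

text \<open>
  The parameter \<open>d\<close> is the number of low-order bits removed by truncation; \<open>signed_drop_bit\<close> is
  the arithmetic right shift of the two's complement integer.
\<close>

primrec eval :: "nat \<Rightarrow> 'l::len memory \<Rightarrow> party \<Rightarrow> expr \<Rightarrow> ('l word \<times> nat) option" where
  "eval d M p (Var x) = M (p, x)"
| "eval d M p Zero = Some (0, 0)"
| "eval d M p (Neg e) = map_option (map_prod uminus id) (eval d M p e)"
| "eval d M p (Plus e f) = lift2 (+) (eval d M p e) (eval d M p f)"
| "eval d M p (Minus e f) = lift2 (-) (eval d M p e) (eval d M p f)"
| "eval d M p (Times e f) = lift2 (*) (eval d M p e) (eval d M p f)"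
| "eval d M p (Trunc e) = map_option (map_prod (signed_drop_bit d) id) (eval d M p e)"

primrec assign :: "nat \<Rightarrow> var \<Rightarrow> expr \<Rightarrow> party list \<Rightarrow> 'l::len memory \<Rightarrow> 'l memory option" where
  "assign d x e [] M = Some M"
| "assign d x e (p # ps) M =
    Option.bind (eval d M p e) (\<lambda>c. assign d x e ps (M((p, x) \<mapsto> c)))"

text \<open>
  Execution of one instruction, where \<open>\<rho>\<close> gives the outcomes of the common sampling. It is stuck
  (\<open>None\<close>) if some party lacks a value that it needs.
\<close>

fun exec :: "nat \<Rightarrow> (var \<Rightarrow> 'l word) \<Rightarrow> stage \<Rightarrow> instr \<Rightarrow> 'l::len config \<Rightarrow> 'l config option" where
  "exec d \<rho> st (Sample ps x) (M, L) = Some (fold (\<lambda>p M. M((p, x) \<mapsto> (\<rho> x, 0))) ps M, L)"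
| "exec d \<rho> st (Assign ps x e) (M, L) = map_option (\<lambda>M'. (M', L)) (assign d x e ps M)"
| "exec d \<rho> st (Send s r x) (M, L) =
    (case M (s, x) of
       None \<Rightarrow> None
     | Some (v, t) \<Rightarrow>
         Some (M((r, x) \<mapsto> (v, t + 1)), L @ [Message st s r (t + 1) (encode v)]))"
| "exec d \<rho> st (Confirm s r e f) (M, L) =
    (case (eval d M s e, eval d M r f) of
       (Some (v, _), Some (w, _)) \<Rightarrow> Some (M, L @ [Claim st s r (encode v) (encode w)])
     | _ \<Rightarrow> None)"

primrec execs ::
    "nat \<Rightarrow> (var \<Rightarrow> 'l word) \<Rightarrow> stage \<Rightarrow> instr list \<Rightarrow> 'l::len config \<Rightarrow> 'l config option" where
  "execs d \<rho> st [] c = Some c"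
| "execs d \<rho> st (i # is) c = Option.bind (exec d \<rho> st i c) (execs d \<rho> st is)"

record 'r sharing =
  masked :: 'r
  share :: "nat \<Rightarrow> 'r"  \<comment> \<open>\<open>share \<alpha> j\<close> is \<open>\<lambda>\<^sup>j\<close> for \<open>j \<in> {1,2,3}\<close>\<close>

definition shares :: "'l::len word sharing \<Rightarrow> 'l word \<Rightarrow> bool" where
  "shares \<alpha> v \<longleftrightarrow> masked \<alpha> = v + (share \<alpha> 1 + share \<alpha> 2 + share \<alpha> 3)"

primrec lambda_indices :: "party \<Rightarrow> nat set" where
  "lambda_indices P0 = {1, 2, 3}"
| "lambda_indices P1 = {1, 3}"
| "lambda_indices P2 = {2, 3}"
| "lambda_indices P3 = {1, 2}"

text \<open>Before the online phase, the parties hold only the \<open>\<lambda>\<close>-shares of the inputs.\<close>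

fun initial_memory :: "'l::len word sharing \<Rightarrow> 'l word sharing \<Rightarrow> 'l memory" where
  "initial_memory \<alpha> \<beta> (p, Lam j WA) = (if j \<in> lambda_indices p then Some (share \<alpha> j, 0) else None)"
| "initial_memory \<alpha> \<beta> (p, Lam j WB) = (if j \<in> lambda_indices p then Some (share \<beta> j, 0) else None)"
| "initial_memory \<alpha> \<beta> _ = None"

text \<open>At the start of the online phase, the round count is reset and the masked inputs are supplied.\<close>

definition start_online :: "'l::len word sharing \<Rightarrow> 'l word sharing \<Rightarrow> 'l memory \<Rightarrow> 'l memory" where
  "start_online \<alpha> \<beta> M =
    fold (\<lambda>p M. M((p, Msk WA) \<mapsto> (masked \<alpha>, 0), (p, Msk WB) \<mapsto> (masked \<beta>, 0))) [P1, P2, P3]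
      (map_option (\<lambda>(v, _). (v, 0)) \<circ> M)"

definition mult_run ::
    "nat \<Rightarrow> bool \<Rightarrow> (var \<Rightarrow> 'l word) \<Rightarrow> 'l word sharing \<Rightarrow> 'l word sharing \<Rightarrow> 'l::len config option" where
  "mult_run d isTr \<rho> \<alpha> \<beta> =
    Option.bind (execs d \<rho> Preprocessing (mult_preprocessing isTr) (initial_memory \<alpha> \<beta>, []))
      (\<lambda>(M, L). Option.bind (execs d \<rho> Online (mult_online isTr) (start_online \<alpha> \<beta> M, L))
        (execs d \<rho> Verification mult_verification))"

text \<open>The log of the first \<open>N\<close> of a sequence of instances.\<close>

definition joint_log :: "(nat \<Rightarrow> 'l::len config) \<Rightarrow> nat \<Rightarrow> event list" where
  "joint_log run N = concat (map (\<lambda>i. snd (run i)) [0..<N])"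

primrec message_bits :: "stage \<Rightarrow> event \<Rightarrow> nat" where
  "message_bits st (Message st' s r k bs) = (if st' = st then length bs else 0)"
| "message_bits st (Claim st' s r bs bs') = 0"

primrec claims_on :: "stage \<Rightarrow> party \<Rightarrow> party \<Rightarrow> event \<Rightarrow> bool" where
  "claims_on st s r (Message st' s' r' k bs) = False"
| "claims_on st s r (Claim st' s' r' bs bs') = (st' = st \<and> s' = s \<and> r' = r)"

primrec claimed :: "event \<Rightarrow> bool list" where
  "claimed (Message st s r k bs) = []"
| "claimed (Claim st s r bs bs') = bs"

primrec expected :: "event \<Rightarrow> bool list" where
  "expected (Message st s r k bs) = []"
| "expected (Claim st s r bs bs') = bs'"

text \<open>
  For each stage, sender and receiver with anything to confirm, a single hash of the
  concatenation over all instances is sent, at the end. Its bits are charged to the stage of the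
  confirmed values.
\<close>

definition batched_hash ::
    "(bool list \<Rightarrow> bool list) \<Rightarrow> event list \<Rightarrow> stage \<Rightarrow> party \<Rightarrow> party \<Rightarrow> bool list" where
  "batched_hash H L st s r = H (concat (map claimed (filter (claims_on st s r) L)))"

definition aborts :: "(bool list \<Rightarrow> bool list) \<Rightarrow> event list \<Rightarrow> party \<Rightarrow> bool" where
  "aborts H L r \<longleftrightarrow> (\<exists>st s. batched_hash H L st s r \<noteq>
     H (concat (map expected (filter (claims_on st s r) L))))"

definition stage_bits :: "(bool list \<Rightarrow> bool list) \<Rightarrow> stage \<Rightarrow> event list \<Rightarrow> nat" where
  "stage_bits H st L =
    (\<Sum>e\<leftarrow>L. message_bits st e) +
    (\<Sum>(s, r) | \<exists>e\<in>set L. claims_on st s r e. length (batched_hash H L st s r))"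

definition preprocessing_bits :: "(bool list \<Rightarrow> bool list) \<Rightarrow> event list \<Rightarrow> nat" where
  "preprocessing_bits H L = stage_bits H Preprocessing L"

definition online_bits :: "(bool list \<Rightarrow> bool list) \<Rightarrow> event list \<Rightarrow> nat" where
  "online_bits H L = stage_bits H Online L + stage_bits H Verification L"

definition online_rounds :: "event list \<Rightarrow> nat" where
  "online_rounds L = Max (insert 0 {k. \<exists>s r bs. Message Online s r k bs \<in> set L})"

end

theory Submission
  imports Defs
begin

text \<open>
  Which party can compute which value, and after how many rounds, does not depend on the data.
  Hence every instance produces a log of the same shape, containing two ring elements sent in
  the preprocessing phase, two sent in the online phase (in parallel, as neither depends on the
  other), and one deferred to the verification stage. There are at most as many batched hashes
  in a stage as ordered pairs of parties, so their total length is bounded independently of the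
  number of instances and vanishes in the amortized limit.
\<close>

lemma length_encode [simp]: "length (encode (x :: 'l::len word)) = LENGTH('l)"
  by (simp add: encode_def)

lemma finite_UNIV_party: "finite (UNIV :: party set)"
proof -
  have "(UNIV :: party set) = {P0, P1, P2, P3}"
    using party.exhaust by blast
  then show ?thesis
    by (metis finite.emptyI finite_insert)
qed

text \<open>Proved by symbolic execution. The words stay existential because only the lengths of
  their encodings matter later; \<open>w9\<close> occurs twice because \<open>P3\<close> confirms
  the same value to \<open>P1\<close> and \<open>P2\<close>. The deferred message has round 2, as
  its sender knows the masked value of \<open>p\<close> only after round 1.\<close>

lemma mult_run_log:
  fixes \<alpha> \<beta> :: "'l::len word sharing"
  shows "\<exists>M (w0 :: 'l word) (w1 :: 'l word) (w2 :: 'l word) (w3 :: 'l word) (w4 :: 'l word)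
      (w5 :: 'l word) (w6 :: 'l word) (w7 :: 'l word) (w8 :: 'l word) (w9 :: 'l word)
      (w10 :: 'l word) (w11 :: 'l word).
    mult_run d isTr \<rho> \<alpha> \<beta> = Some (M,
      [Message Preprocessing P0 P1 1 (encode w0),
       Claim Preprocessing P3 P1 (encode w1) (encode w2),
       Message Preprocessing P0 P3 1 (encode w3),
       Message Online P1 P2 1 (encode w4),
       Message Online P2 P1 1 (encode w5),
       Message Verification P1 P3 2 (encode w6),
       Claim Verification P2 P3 (encode w7) (encode w8),
       Claim Verification P3 P1 (encode w9) (encode w10),
       Claim Verification P3 P2 (encode w9) (encode w11)])"
  unfolding mult_run_def mult_preprocessing_def jsh03_def jsh12_preprocessing_def jsnd_def
    mult_online_def jsh12_online_def mult_verification_def jsh12_deferred_def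
  \<comment> \<open>Once \<open>isTr\<close> is fixed, the instruction list is concrete: simp runs
    it to a final memory and log, from which blast reads off the witnesses.\<close>
  by (cases isTr; simp add: start_online_def Let_def; blast)

lemma mult_run_bits_rounds:
  fixes \<alpha> \<beta> :: "'l::len word sharing"
  shows "\<exists>c. mult_run d isTr \<rho> \<alpha> \<beta> = Some c \<and>
    (\<Sum>e\<leftarrow>snd c. message_bits Preprocessing e) = 2 * LENGTH('l) \<and>
    (\<Sum>e\<leftarrow>snd c. message_bits Online e) = 2 * LENGTH('l) \<and>
    (\<Sum>e\<leftarrow>snd c. message_bits Verification e) = LENGTH('l) \<and>
    online_rounds (snd c) = 1"
proof -
  obtain M w0 w1 w2 w3 w4 w5 w6 w7 w8 w9 w10 w11 where
    run: "mult_run d isTr \<rho> \<alpha> \<beta> = Some (M,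
      [Message Preprocessing P0 P1 1 (encode (w0 :: 'l word)),
       Claim Preprocessing P3 P1 (encode (w1 :: 'l word)) (encode (w2 :: 'l word)),
       Message Preprocessing P0 P3 1 (encode (w3 :: 'l word)),
       Message Online P1 P2 1 (encode (w4 :: 'l word)),
       Message Online P2 P1 1 (encode (w5 :: 'l word)),
       Message Verification P1 P3 2 (encode (w6 :: 'l word)),
       Claim Verification P2 P3 (encode (w7 :: 'l word)) (encode (w8 :: 'l word)),
       Claim Verification P3 P1 (encode (w9 :: 'l word)) (encode (w10 :: 'l word)),
       Claim Verification P3 P2 (encode w9) (encode (w11 :: 'l word))])"
    (is "_ = Some (M, ?L)")
    using mult_run_log[of d isTr \<rho> \<alpha> \<beta>] by blast
  \<comment> \<open>The deferred message of round 2 is labelled \<open>Verification\<close>, so only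
    the parallel exchange of \<open>w4\<close> and \<open>w5\<close> remains.\<close>
  have "{k. \<exists>s r bs. Message Online s r k bs \<in> set ?L} = {1}"
    by auto
  then have "online_rounds ?L = 1"
    unfolding online_rounds_def by simp
  with run show ?thesis
    by simp
qed

text \<open>A pair of parties contributes a single hash of \<kappa> bits however many claims it
  batches, so the length of \<open>L\<close> does not enter the bound.\<close>

lemma hash_bits_le:
  assumes "\<And>x. length (H x) = \<kappa>"
  shows "(\<Sum>(s, r) | \<exists>e\<in>set L. claims_on st s r e. length (batched_hash H L st s r))
    \<le> card (UNIV :: (party \<times> party) set) * \<kappa>"
proof -
  have "finite (UNIV :: (party \<times> party) set)"
    using finite_UNIV_party by (simp add: finite_prod)
  then have "card {(s, r). \<exists>e\<in>set L. claims_on st s r e} \<le> card (UNIV :: (party \<times> party) set)"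
    by (intro card_mono) auto
  then show ?thesis
    by (simp add: batched_hash_def assms case_prod_unfold)
qed

lemma joint_message_bits:
  assumes "\<And>i. (\<Sum>e\<leftarrow>snd (run i). message_bits st e) = c"
  shows "(\<Sum>e\<leftarrow>joint_log run N. message_bits st e) = N * c"
  by (induction N) (simp_all add: joint_log_def assms)

text \<open>Sandwich argument: the hashes add between 0 and \<open>?K\<close> bits to the
  \<open>N * c\<close> message bits, so the quotient lies between \<open>c\<close> and
  \<open>c + ?K / N\<close>.\<close>

lemma amortized_stage_bits:
  assumes "\<And>x. length (H x) = \<kappa>"
    and "\<And>i. (\<Sum>e\<leftarrow>snd (run i). message_bits st e) = c"
  shows "(\<lambda>N. real (stage_bits H st (joint_log run N)) / real N) \<longlonglongrightarrow> real c"
proof (rule tendsto_sandwich)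
  let ?K = "card (UNIV :: (party \<times> party) set) * \<kappa>"
  have bounds: "N * c \<le> stage_bits H st (joint_log run N)"
    "stage_bits H st (joint_log run N) \<le> N * c + ?K" for N
    using joint_message_bits[of st run c N, OF assms(2)]
      hash_bits_le[where L = "joint_log run N" and st = st, OF assms(1)]
    by (simp_all add: stage_bits_def)
  \<comment> \<open>At \<open>N = 0\<close> the quotient is 0 by convention and this bound fails for
    positive \<open>c\<close>; it is needed only eventually.\<close>
  have "real c \<le> real (stage_bits H st (joint_log run N)) / real N" if "0 < N" for N
    using of_nat_mono[OF bounds(1)[of N], where 'a = real] that by (simp add: field_simps)
  then show "\<forall>\<^sub>F N in sequentially. real c \<le> real (stage_bits H st (joint_log run N)) / real N"
    using eventually_gt_at_top by (rule eventually_mono[rotated])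
  have "real (stage_bits H st (joint_log run N)) / real N \<le> real c + real ?K / real N"
    if "0 < N" for N
    using of_nat_mono[OF bounds(2)[of N], where 'a = real] that by (simp add: field_simps)
  then show "\<forall>\<^sub>F N in sequentially.
      real (stage_bits H st (joint_log run N)) / real N \<le> real c + real ?K / real N"
    using eventually_gt_at_top by (rule eventually_mono[rotated])
  show "(\<lambda>N. real c + real ?K / real N) \<longlonglongrightarrow> real c"
    using tendsto_add[OF tendsto_const lim_const_over_n] by fastforce
qed simp

theorem lemmaB4:
  fixes H :: "bool list \<Rightarrow> bool list" and \<kappa> d :: nat and isTr :: bool
    and a b :: "nat \<Rightarrow> 'l::len word"
    and \<alpha> \<beta> :: "nat \<Rightarrow> 'l word sharing"
    and \<rho> :: "nat \<Rightarrow> var \<Rightarrow> 'l word"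
  assumes hash_length: "\<And>x. length (H x) = \<kappa>"
    and shared_a: "\<And>i. shares (\<alpha> i) (a i)"
    and shared_b: "\<And>i. shares (\<beta> i) (b i)"
  shows "\<exists>run. (\<forall>i. mult_run d isTr (\<rho> i) (\<alpha> i) (\<beta> i) = Some (run i)) \<and>
    (\<lambda>N. real (preprocessing_bits H (joint_log run N)) / real N)
      \<longlonglongrightarrow> real (2 * LENGTH('l)) \<and>
    (\<forall>i. online_rounds (snd (run i)) = 1) \<and>
    (\<lambda>N. real (online_bits H (joint_log run N)) / real N)
      \<longlonglongrightarrow> real (3 * LENGTH('l))"
proof -
  \<comment> \<open>\<open>the\<close> is harmless: \<open>mult_run_bits_rounds\<close> shows that
    no instance gets stuck.\<close>
  define run where "run i = the (mult_run d isTr (\<rho> i) (\<alpha> i) (\<beta> i))" for i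
  have run: "mult_run d isTr (\<rho> i) (\<alpha> i) (\<beta> i) = Some (run i)"
    and preprocessing: "(\<Sum>e\<leftarrow>snd (run i). message_bits Preprocessing e) = 2 * LENGTH('l)"
    and online: "(\<Sum>e\<leftarrow>snd (run i). message_bits Online e) = 2 * LENGTH('l)"
    and verification: "(\<Sum>e\<leftarrow>snd (run i). message_bits Verification e) = LENGTH('l)"
    and rounds: "online_rounds (snd (run i)) = 1" for i
    using mult_run_bits_rounds[of d isTr "\<rho> i" "\<alpha> i" "\<beta> i"] by (auto simp: run_def)
  have "(\<lambda>N. real (preprocessing_bits H (joint_log run N)) / real N)
      \<longlonglongrightarrow> real (2 * LENGTH('l))"
    unfolding preprocessing_bits_def using hash_length preprocessing by (rule amortized_stage_bits)
  moreover have "(\<lambda>N. real (online_bits H (joint_log run N)) / real N)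
      \<longlonglongrightarrow> real (3 * LENGTH('l))"
    \<comment> \<open>The online cost 3\<ell> splits as 2\<ell> for the exchange and \<ell> for the
      deferred send to \<open>P3\<close>.\<close>
    using tendsto_add[OF amortized_stage_bits[of H, OF hash_length online]
        amortized_stage_bits[of H, OF hash_length verification]]
    by (simp add: online_bits_def add_divide_distrib)
  ultimately show ?thesis
    using run rounds by blast
qed

end
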